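(* For every integer $n\ge 2$, $$\gamma_1^{\mathrm L}(P_n\square P_3)=3\left\lceil\frac{n}{2}\right\rceil.$$
   Context: All graphs are finite and simple; $N_G(u)$ is the open neighborhood of $u$ in $G$, and $P_n$ is the path on $n$ vertices. A set $D\subseteq V(G)$ is a dominating set if every vertex of $V(G)\setminus D$ has a neighbor in $D$. A dominating set $D$ of $G$ is a $1$-limited dominating set if $|N_G(u)\setminus D|\le 1$ for every $u\in D$. The $1$-limited domination number $\gamma_1^{\mathrm L}(G)$ is the minimum cardinality of a $1$-limited dominating set of $G$. The Cartesian product $G\square H$ has vertex set $V(G)\times V(H)$, with $(g,h)$ and $(g',h')$ adjacent if and only if either $g=g'$ and $hh'\in E(H)$, or $h=h'$ and $gg'\in E(G)$. *)

theory Defs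
  imports Complex_Main "Graph_Theory.Pair_Digraph"
begin

text \<open>
  Finite simple graphs are values of type \<open>'a pair_pre_digraph\<close> satisfying the locale
  predicate \<^const>\<open>pair_graph\<close>: finite, loop-free, without parallel arcs and with a
  symmetric arc relation, so that an edge is represented by its two orientations.
\<close>

definition neighborhood :: "'a pair_pre_digraph \<Rightarrow> 'a \<Rightarrow> 'a set" where
  "neighborhood G u = {v \<in> pverts G. (u, v) \<in> parcs G}"

definition dominating_set :: "'a pair_pre_digraph \<Rightarrow> 'a set \<Rightarrow> bool" where
  "dominating_set G D \<longleftrightarrow>
     D \<subseteq> pverts G \<and> (\<forall>v \<in> pverts G - D. \<exists>u \<in> D. u \<in> neighborhood G v)"

definition one_limited_dominating_set :: "'a pair_pre_digraph \<Rightarrow> 'a set \<Rightarrow> bool" where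
  "one_limited_dominating_set G D \<longleftrightarrow>
     dominating_set G D \<and> (\<forall>u \<in> D. card (neighborhood G u - D) \<le> 1)"

text \<open>
  For a finite graph the minimum below is over a finite nonempty set, since the whole vertex
  set is always a 1-limited dominating set.
\<close>

definition one_limited_domination_number :: "'a pair_pre_digraph \<Rightarrow> nat" where
  "one_limited_domination_number G = Min (card ` {D. one_limited_dominating_set G D})"

definition path_graph :: "nat \<Rightarrow> nat pair_pre_digraph" where
  "path_graph n =
     \<lparr> pverts = {..<n}, parcs = {(i, j). i < n \<and> j < n \<and> (j = Suc i \<or> i = Suc j)} \<rparr>"

definition cartesian_product ::
    "'a pair_pre_digraph \<Rightarrow> 'b pair_pre_digraph \<Rightarrow> ('a \<times> 'b) pair_pre_digraph" (infixr \<open>\<box>\<close> 80) where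
  "G \<box> H =
     \<lparr> pverts = pverts G \<times> pverts H,
       parcs = {((g, h), (g', h')).
         g \<in> pverts G \<and> g' \<in> pverts G \<and> h \<in> pverts H \<and> h' \<in> pverts H \<and>
         (g = g' \<and> (h, h') \<in> parcs H \<or> h = h' \<and> (g, g') \<in> parcs G)} \<rparr>"

lemma pair_graph_path_graph: "pair_graph (path_graph n)"
proof
  show "finite (parcs (path_graph n))"
    by (rule finite_subset[of _ "{..<n} \<times> {..<n}"]) (auto simp: path_graph_def)
  show "symmetric (path_graph n)"
    by (auto simp: path_graph_def symmetric_def intro: symI)
qed (auto simp: path_graph_def)

lemma pair_graph_cartesian_product:
  assumes "pair_graph G" and "pair_graph H"
  shows "pair_graph (G \<box> H)"
proof -
  interpret G: pair_graph G by fact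
  interpret H: pair_graph H by fact
  have sym: "sym (parcs G)" "sym (parcs H)"
    using G.pair_sym_arcs H.pair_sym_arcs by (simp_all add: symmetric_def)
  show ?thesis
  proof
    show "finite (parcs (G \<box> H))"
      by (rule finite_subset[of _ "(pverts G \<times> pverts H) \<times> (pverts G \<times> pverts H)"])
        (auto simp: cartesian_product_def G.pair_finite_verts H.pair_finite_verts)
    show "symmetric (G \<box> H)"
      using sym by (auto simp: cartesian_product_def symmetric_def sym_def)
    show "finite (pverts (G \<box> H))"
      by (simp add: cartesian_product_def G.pair_finite_verts H.pair_finite_verts)
  qed (use G.pair_no_loops H.pair_no_loops in \<open>fastforce simp: cartesian_product_def\<close>)+
qed

lemma one_limited_domination_number_attained:
  assumes "pair_graph G"
  shows "\<exists>D. one_limited_dominating_set G D \<and> card D = one_limited_domination_number G"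
    and "one_limited_dominating_set G D \<Longrightarrow> one_limited_domination_number G \<le> card D"
proof -
  interpret pair_graph G by fact
  let ?S = "{D. one_limited_dominating_set G D}"
  have fin: "finite ?S"
    by (rule finite_subset[of _ "Pow (pverts G)"])
      (auto simp: one_limited_dominating_set_def dominating_set_def pair_finite_verts)
  have "card (neighborhood G u - pverts G) \<le> 1" for u
  proof -
    have "neighborhood G u - pverts G = {}"
      by (auto simp: neighborhood_def)
    then show ?thesis by (metis card.empty zero_le)
  qed
  then have "pverts G \<in> ?S"
    unfolding one_limited_dominating_set_def dominating_set_def by blast
  with fin have "Min (card ` ?S) \<in> card ` ?S"
    by (intro Min_in) auto
  then show "\<exists>D. one_limited_dominating_set G D \<and> card D = one_limited_domination_number G"
    unfolding one_limited_domination_number_def by fastforce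
  show "one_limited_dominating_set G D \<Longrightarrow> one_limited_domination_number G \<le> card D"
    unfolding one_limited_domination_number_def using fin by (intro Min_le) auto
qed

end

theory Submission
  imports Defs
begin

text \<open>
  Call the copies of \<open>P\<^sub>3\<close> columns. For the upper bound take
  \<open>\<lceil>n / 2\<rceil>\<close> full columns in a pattern of period 4, two full columns alternating with
  two empty ones, starting with a single full column unless \<open>n mod 4 = 3\<close>, when it starts
  with a single empty one.

  The lower bound is a dynamic program over the columns. Let \<open>W\<^sub>m\<close> be the number of chosen
  vertices in the first \<open>m\<close> columns, \<open>a\<close> the last of these columns and \<open>b\<close> the one
  after it, and write \<open>|a|\<close> for the number of chosen vertices in \<open>a\<close>. Then, for \<open>m \<ge> 2\<close>,
  \<open>W\<^sub>m \<ge> 3 m / 2 + surplus a b\<close> if \<open>m\<close> is even and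
  \<open>W\<^sub>m + max 0 (|b| - |a|) \<ge> 3 (m + 1) / 2\<close> if \<open>m\<close> is odd; each follows from the other by a
  check of all consecutive columns. Reflecting the grid at its last column gives
  \<open>b = a\<close> for \<open>m = n\<close>, and the correction terms disappear.
\<close>

type_synonym column = "bool \<times> bool \<times> bool"

fun weight :: "column \<Rightarrow> nat" where
  "weight (x0, x1, x2) = of_bool x0 + of_bool x1 + of_bool x2"

text \<open>
  The conditions on a dominating set at the vertices of a column with left and right
  neighbours: a chosen vertex has no two unchosen neighbours, an unchosen one has a chosen
  neighbour. In the first and last column the missing neighbour is replaced by the column itself,
  which adds no constraint: the mirror image of a vertex is chosen exactly when the vertex is.
\<close>
fun admissible :: "column \<Rightarrow> column \<Rightarrow> column \<Rightarrow> bool" where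
  "admissible (l0, l1, l2) (x0, x1, x2) (r0, r1, r2) \<longleftrightarrow>
     (if x0 then (l0 \<or> x1) \<and> (l0 \<or> r0) \<and> (x1 \<or> r0) else l0 \<or> x1 \<or> r0) \<and>
     (if x1 then (l1 \<or> r1) \<and> (l1 \<or> x0) \<and> (l1 \<or> x2) \<and> (r1 \<or> x0) \<and> (r1 \<or> x2) \<and> (x0 \<or> x2)
      else l1 \<or> r1 \<or> x0 \<or> x2) \<and>
     (if x2 then (l2 \<or> x1) \<and> (l2 \<or> r2) \<and> (x1 \<or> r2) else l2 \<or> x1 \<or> r2)"

text \<open>The values are large enough for \<open>weight_step_even\<close> and small enough for
  \<open>weight_start\<close> and \<open>weight_step_odd\<close>.\<close>

definition surplus :: "column \<Rightarrow> column \<Rightarrow> nat" where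
  "surplus a b = (if weight a = 0 then 0 else if weight a = 3 then 3 - weight b else 1)"

lemma weight_start:
  assumes "admissible a a b" "admissible a b c"
  shows "3 + surplus b c \<le> weight a + weight b"
  using assms
  by (cases a; cases b; cases c) (auto simp: surplus_def split: if_splits)

text \<open>By truncated subtraction the last two terms add up to max |b| |c|. An empty
  \<open>a\<close> uses up the one unchosen neighbour allowed to each chosen vertex of
  \<open>b\<close>, so \<open>b\<close> is full or empty, and an empty \<open>b\<close> needs a full
  \<open>c\<close>. A full \<open>a\<close> has surplus 3 - |b|. For any other \<open>a\<close>, one
  of \<open>b\<close> and \<open>c\<close> has at least two chosen vertices.\<close>

lemma weight_step_even:
  assumes "admissible z a b" "admissible a b c"
  shows "3 \<le> surplus a b + weight b + (weight c - weight b)"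
  using assms
  by (cases z; cases a; cases b; cases c) (auto simp: surplus_def split: if_splits)

text \<open>By truncated subtraction this bounds the surplus by min |a| |b|. If \<open>b\<close> is
  full, each of its vertices needs a chosen neighbour to the left or right, so |a| + |c| \<ge> 3. If
  \<open>b\<close> is neither full nor empty, \<open>a\<close> cannot be empty.\<close>

lemma weight_step_odd:
  assumes "admissible z a b" "admissible a b c"
  shows "surplus b c + (weight b - weight a) \<le> weight b"
  using assms
  by (cases z; cases a; cases b; cases c) (auto simp: surplus_def split: if_splits)


lemma sum_weight_ge:
  assumes n: "2 \<le> n" and refl_end: "c n = c (n - 1)"
    and adm: "\<And>i. i < n \<Longrightarrow> admissible (c (i - 1)) (c i) (c (Suc i))"
  shows "3 * ((n + 1) div 2) \<le> (\<Sum>i<n. weight (c i))"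
proof -
  let ?W = "\<lambda>m. \<Sum>i<m. weight (c i)"
  let ?inv = "\<lambda>m. if even m then 3 * m + 2 * surplus (c (m - 1)) (c m) \<le> 2 * ?W m
    else 3 * m + 3 \<le> 2 * (?W m + (weight (c m) - weight (c (m - 1))))"
  have inv: "m \<le> n \<longrightarrow> ?inv m" if "2 \<le> m" for m
    using that
  proof (induction m rule: dec_induct)
    case base
    show ?case
      using weight_start[of "c 0" "c 1" "c 2"] adm[of 0] adm[of 1] n
      by (simp add: eval_nat_numeral)
  next
    case (step m)
    show ?case
    proof
      assume "Suc m \<le> n"
      with step have IH: "?inv m" by simp
      have a: "admissible (c (m - 2)) (c (m - 1)) (c m)"
        using adm[of "m - 1"] \<open>Suc m \<le> n\<close> step.hyps
        by (simp add: numeral_2_eq_2 Suc_diff_Suc)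
      have b: "admissible (c (m - 1)) (c m) (c (Suc m))"
        using adm[of m] \<open>Suc m \<le> n\<close> by simp
      show "?inv (Suc m)"
        using IH weight_step_even[OF a b] weight_step_odd[OF a b]
        by (cases "even m") simp_all
    qed
  qed
  from inv[OF n] have "?inv n" by simp
  then have "3 * n + (if even n then 0 else 3) \<le> 2 * ?W n"
    by (simp add: refl_end split: if_splits)
  then show ?thesis
    by (cases "even n") (auto elim!: evenE oddE)
qed

definition column :: "(nat \<times> nat) set \<Rightarrow> nat \<Rightarrow> column" where
  "column D i = ((i, 0) \<in> D, (i, 1) \<in> D, (i, 2) \<in> D)"

lemma card_eq_sum_weight:
  assumes "D \<subseteq> {..<n} \<times> {..<3}"
  shows "card D = (\<Sum>i<n. weight (column D i))"
proof -
  have "card D = (\<Sum>p \<in> {..<n} \<times> {..<3}. of_bool (p \<in> D))"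
    using assms by (simp add: Int_absorb1)
  also have "\<dots> = (\<Sum>i<n. \<Sum>j<3. of_bool ((i, j) \<in> D))"
    unfolding sum.cartesian_product by (rule sum.cong) auto
  also have "\<dots> = (\<Sum>i<n. weight (column D i))"
    by (simp add: column_def eval_nat_numeral del: sum_of_bool_eq)
  finally show ?thesis .
qed

lemma pverts_grid: "pverts (path_graph n \<box> path_graph m) = {..<n} \<times> {..<m}"
  by (simp add: cartesian_product_def path_graph_def)

lemma neighborhood_grid:
  "(i', j') \<in> neighborhood (path_graph n \<box> path_graph m) (i, j) \<longleftrightarrow>
     i < n \<and> i' < n \<and> j < m \<and> j' < m \<and>
     (i = i' \<and> (j' = Suc j \<or> j = Suc j') \<or> j = j' \<and> (i' = Suc i \<or> i = Suc i'))"
  by (auto simp: neighborhood_def cartesian_product_def path_graph_def)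

lemma finite_neighborhood_grid: "finite (neighborhood (path_graph n \<box> path_graph m) u)"
  by (rule finite_subset[of _ "{..<n} \<times> {..<m}"]) (auto simp: neighborhood_def pverts_grid)

lemma admissible_column:
  assumes D: "one_limited_dominating_set (path_graph n \<box> path_graph 3) D"
    and "2 \<le> n" "i < n"
  shows "admissible (column D (i - 1)) (column D i) (column D (min (Suc i) (n - 1)))"
proof -
  let ?N = "neighborhood (path_graph n \<box> path_graph 3)"
  define r where "r = min (Suc i) (n - 1)"
  have r: "r = Suc i \<and> Suc i < n \<or> r = i \<and> Suc i = n"
    using \<open>i < n\<close> by (auto simp: r_def)
  \<comment> \<open>At the ends of the grid a mirrored neighbour is \<open>p\<close> itself; the
    alternatives \<open>q = p\<close> and \<open>q' = p\<close> cover it.\<close>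
  have lim: "q \<in> D \<or> q' \<in> D"
    if "p \<in> D" "q = p \<or> q' = p \<or> q \<in> ?N p \<and> q' \<in> ?N p \<and> q \<noteq> q'" for p q q'
  proof (rule ccontr)
    assume "\<not> ?thesis"
    with that have "q \<in> ?N p - D" "q' \<in> ?N p - D" "q \<noteq> q'" by auto
    moreover have "card (?N p - D) \<le> Suc 0"
      using D \<open>p \<in> D\<close> by (auto simp: one_limited_dominating_set_def)
    ultimately show False
      by (metis card_le_Suc0_iff_eq finite_Diff finite_neighborhood_grid)
  qed
  have dom: "\<exists>q \<in> D. q \<in> ?N (i, j)" if "j < 3" "(i, j) \<notin> D" for j
    using D that \<open>i < n\<close>
    by (auto simp: one_limited_dominating_set_def dominating_set_def pverts_grid)
  have dom0: "(i - 1, 0) \<in> D \<or> (i, 1) \<in> D \<or> (r, 0) \<in> D" if "(i, 0) \<notin> D"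
    using dom[of 0] that r by (auto simp: neighborhood_grid)
  have dom1: "(i - 1, 1) \<in> D \<or> (r, 1) \<in> D \<or> (i, 0) \<in> D \<or> (i, 2) \<in> D" if "(i, 1) \<notin> D"
    using dom[of 1] that r by (auto simp: neighborhood_grid numeral_2_eq_2)
  have dom2: "(i - 1, 2) \<in> D \<or> (i, 1) \<in> D \<or> (r, 2) \<in> D" if "(i, 2) \<notin> D"
    using dom[of 2] that r by (auto simp: neighborhood_grid numeral_2_eq_2)
  have lim0: "((i - 1, 0) \<in> D \<or> (i, 1) \<in> D) \<and> ((i - 1, 0) \<in> D \<or> (r, 0) \<in> D) \<and>
      ((i, 1) \<in> D \<or> (r, 0) \<in> D)" if "(i, 0) \<in> D"
    using r \<open>i < n\<close> by (intro conjI lim[OF that]) (auto simp: neighborhood_grid)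
  have lim1: "((i - 1, 1) \<in> D \<or> (r, 1) \<in> D) \<and> ((i - 1, 1) \<in> D \<or> (i, 0) \<in> D) \<and>
      ((i - 1, 1) \<in> D \<or> (i, 2) \<in> D) \<and> ((r, 1) \<in> D \<or> (i, 0) \<in> D) \<and>
      ((r, 1) \<in> D \<or> (i, 2) \<in> D) \<and> ((i, 0) \<in> D \<or> (i, 2) \<in> D)" if "(i, 1) \<in> D"
    using r \<open>i < n\<close> by (intro conjI lim[OF that]) (auto simp: neighborhood_grid)
  have lim2: "((i - 1, 2) \<in> D \<or> (i, 1) \<in> D) \<and> ((i - 1, 2) \<in> D \<or> (r, 2) \<in> D) \<and>
      ((i, 1) \<in> D \<or> (r, 2) \<in> D)" if "(i, 2) \<in> D"
    using r \<open>i < n\<close> by (intro conjI lim[OF that]) (auto simp: neighborhood_grid)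
  show ?thesis
    using dom0 lim0 dom1 lim1 dom2 lim2
    unfolding column_def admissible.simps r_def[symmetric] if_bool_eq_conj
    by blast
qed

text \<open>Vertical neighbours lie in the same column and share its status, so only the columns to
  the left and right matter. The first and last columns have at most one of these, hence
  \<open>full\<close> asks nothing of them.\<close>

lemma one_limited_dominating_set_columns:
  assumes full: "\<And>i. \<lbrakk>i < n; P i; i \<noteq> 0; Suc i < n\<rbrakk> \<Longrightarrow> P (i - 1) \<or> P (Suc i)"
    and empty: "\<And>i. \<lbrakk>i < n; \<not> P i\<rbrakk> \<Longrightarrow> i \<noteq> 0 \<and> P (i - 1) \<or> Suc i < n \<and> P (Suc i)"
  shows "one_limited_dominating_set (path_graph n \<box> path_graph 3) ({i. i < n \<and> P i} \<times> {..<3})"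
    (is "one_limited_dominating_set ?G ?D")
proof -
  have "\<exists>q \<in> ?D. q \<in> neighborhood ?G p" if "p \<in> pverts ?G - ?D" for p
  proof -
    obtain i j where p: "p = (i, j)" "i < n" "j < 3" "\<not> P i"
      using \<open>p \<in> pverts ?G - ?D\<close> by (auto simp: pverts_grid)
    from empty[OF p(2,4)] show ?thesis
    proof
      assume "i \<noteq> 0 \<and> P (i - 1)"
      with p show ?thesis by (intro bexI[of _ "(i - 1, j)"]) (auto simp: neighborhood_grid)
    next
      assume "Suc i < n \<and> P (Suc i)"
      with p show ?thesis by (intro bexI[of _ "(Suc i, j)"]) (auto simp: neighborhood_grid)
    qed
  qed
  moreover have "card (neighborhood ?G p - ?D) \<le> 1" if "p \<in> ?D" for p
  proof -
    obtain i j where p: "p = (i, j)" "i < n" "j < 3" "P i"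
      using \<open>p \<in> ?D\<close> by auto
    have "x = y" if "x \<in> neighborhood ?G p - ?D" "y \<in> neighborhood ?G p - ?D" for x y
      using that p full[OF p(2,4)] by (cases x; cases y) (auto simp: neighborhood_grid)
    then show ?thesis
      by (simp add: card_le_Suc0_iff_eq finite_neighborhood_grid)
  qed
  ultimately show ?thesis
    by (auto simp: one_limited_dominating_set_def dominating_set_def pverts_grid)
qed

lemma card_less_Suc_Collect:
  "card {i. i < Suc n \<and> P i} = card {i. i < n \<and> P i} + of_bool (P n)"
proof -
  have "{i. i < Suc n \<and> P i} = {i. i < n \<and> P i} \<union> (if P n then {n} else {})"
    by (auto simp: less_Suc_eq)
  then show ?thesis by simp
qed

lemma card_mod_4_03:
  "card {i. i < n \<and> (i mod 4 = 0 \<or> i mod 4 = 3)} = 2 * (n div 4) + of_bool (n mod 4 \<noteq> 0)"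
proof (induction n)
  case (Suc n)
  consider "n mod 4 = 0" | "n mod 4 = 1" | "n mod 4 = 2" | "n mod 4 = 3" by linarith
  then show ?case
    using Suc by cases (simp_all add: card_less_Suc_Collect mod_Suc div_Suc)
qed simp

text \<open>Truncated subtraction makes the last term 0 also when 4 divides
  \<open>n\<close>.\<close>

lemma card_mod_4_12:
  "card {i. i < n \<and> (i mod 4 = 1 \<or> i mod 4 = 2)} = 2 * (n div 4) + (n mod 4 - 1)"
proof (induction n)
  case (Suc n)
  consider "n mod 4 = 0" | "n mod 4 = 1" | "n mod 4 = 2" | "n mod 4 = 3" by linarith
  then show ?case
    using Suc by cases (simp_all add: card_less_Suc_Collect mod_Suc div_Suc)
qed simp

theorem theorem16:
  fixes n :: nat
  assumes "n \<ge> 2"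
  shows "int (one_limited_domination_number (path_graph n \<box> path_graph 3)) = 3 * \<lceil>real n / 2\<rceil>"
proof -
  let ?G = "path_graph n \<box> path_graph 3"
  have G: "pair_graph ?G"
    by (intro pair_graph_cartesian_product pair_graph_path_graph)
  have "one_limited_domination_number ?G \<le> 3 * ((n + 1) div 2)"
  proof -
    \<comment> \<open>With residues 0 and 3 and \<open>n mod 4 = 3\<close>, the last two columns
      would both be empty and the last one undominated; the shift by one makes them both
      full.\<close>
    define P where "P i \<longleftrightarrow> (if n mod 4 = 3 then i mod 4 = 1 \<or> i mod 4 = 2
      else i mod 4 = 0 \<or> i mod 4 = 3)" for i :: nat
    have "one_limited_dominating_set ?G ({i. i < n \<and> P i} \<times> {..<3})"
    proof (rule one_limited_dominating_set_columns)
      show "P (i - 1) \<or> P (Suc i)" if "P i" "i \<noteq> 0" for i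
        using that by (cases i) (auto simp: P_def mod_Suc split: if_splits)
      fix i assume i: "i < n" "\<not> P i"
      consider "i mod 4 = 0" | "i mod 4 = 1" | "i mod 4 = 2" | "i mod 4 = 3" by linarith
      moreover from i have "n = Suc i \<or> Suc i < n" by auto
      ultimately show "i \<noteq> 0 \<and> P (i - 1) \<or> Suc i < n \<and> P (Suc i)"
        using i(2) by cases (cases i; auto simp: P_def mod_Suc split: if_splits)+
    qed
    moreover have "card {i. i < n \<and> P i} = (n + 1) div 2"
    proof -
      define q where "q = n div 4"
      have "card {i. i < n \<and> P i} =
          2 * q + (if n mod 4 = 3 then 2 else of_bool (n mod 4 \<noteq> 0))"
        by (simp add: P_def card_mod_4_03 card_mod_4_12 q_def del: One_nat_def)
      moreover consider "n = 4 * q" | "n = 4 * q + 1" | "n = 4 * q + 2" | "n = 4 * q + 3"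
        unfolding q_def by linarith
      then have "2 * q + (if n mod 4 = 3 then 2 else of_bool (n mod 4 \<noteq> 0)) = (n + 1) div 2"
        by cases (simp_all add: mod_Suc)
      ultimately show ?thesis by simp
    qed
    ultimately show ?thesis
      using one_limited_domination_number_attained(2)[OF G]
      by (metis card_cartesian_product card_lessThan mult.commute)
  qed
  moreover have "3 * ((n + 1) div 2) \<le> one_limited_domination_number ?G"
  proof -
    obtain D where D: "one_limited_dominating_set ?G D"
      and card: "card D = one_limited_domination_number ?G"
      using one_limited_domination_number_attained(1)[OF G] by blast
    \<comment> \<open>Extending by the last column gives \<open>c n = c (n - 1)\<close>; on the
      left, \<open>0 - 1 = 0\<close> reflects the first column.\<close>
    define c where "c i = column D (min i (n - 1))" for i
    have "3 * ((n + 1) div 2) \<le> (\<Sum>i<n. weight (c i))"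
    proof (rule sum_weight_ge[OF assms])
      fix i assume "i < n"
      with assms have "min (i - 1) (n - 1) = i - 1" "min i (n - 1) = i" by auto
      with admissible_column[OF D assms \<open>i < n\<close>]
      show "admissible (c (i - 1)) (c i) (c (Suc i))" by (simp add: c_def)
    qed (simp add: c_def)
    also have "\<dots> = (\<Sum>i<n. weight (column D i))"
      by (intro sum.cong) (auto simp: c_def min_def)
    also have "\<dots> = card D"
      using D by (intro card_eq_sum_weight[symmetric])
        (simp add: one_limited_dominating_set_def dominating_set_def pverts_grid)
    finally show ?thesis by (simp add: card)
  qed
  moreover have "\<lceil>real n / 2\<rceil> = int ((n + 1) div 2)"
    by (cases "even n") (auto elim!: evenE oddE simp: ceiling_eq_iff)
  ultimately show ?thesis by simp
qed

end
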